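(* Let $\mathbb{F}_q$ be a finite field of characteristic $p$ with $q$ elements, and let $k$ and $d$ be positive integers with $k>d$, $p>d+1$, and $q>k+d$. Assume further that $p\mid (k+d)$. Let $\mathbf{w}_d\in\mathbb{F}_q^{q-1}$ be the word generated by the polynomial $T^{k+d}\in\mathbb{F}_q[T]$. Then $\mathbf{w}_d$ is not a deep hole of the standard Reed--Solomon code $C$ of dimension $k$ over $\mathbb{F}_q$.
   Context: Write $\mathbb{F}_q^*=\{x_1,\ldots,x_{q-1}\}$ for the set of nonzero elements of $\mathbb{F}_q$. The standard Reed--Solomon code of dimension $k$ over $\mathbb{F}_q$ is $$C=\{(g(x_1),\ldots,g(x_{q-1})) : g\in\mathbb{F}_q[T],\ \deg g\le k-1\}\subset\mathbb{F}_q^{q-1}.$$ The word generated by a polynomial $f\in\mathbb{F}_q[T]$ is $(f(x_1),\ldots,f(x_{q-1}))\in\mathbb{F}_q^{q-1}$. For $\mathbf{w}\in\mathbb{F}_q^{q-1}$, the distance to the code is $\mathsf{d}(\mathbf{w},C)=\min_{\mathbf{c}\in C}\mathsf{d}(\mathbf{w},\mathbf{c})$, where $\mathsf{d}$ is the Hamming distance. The covering radius of $C$ is $\rho=\max_{\mathbf{y}\in\mathbb{F}_q^{q-1}}\mathsf{d}(\mathbf{y},C)$ (it is well known that $\rho=q-1-k$). A word $\mathbf{w}$ is a deep hole of $C$ if $\mathsf{d}(\mathbf{w},C)=\rho$. *)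

theory Defs
  imports "HOL-Computational_Algebra.Computational_Algebra" "HOL-Library.Cardinality"
begin

text \<open>
  Words over a finite field are lists over the field type.  A list \<open>xs\<close> enumerates the nonzero
  field elements \<open>x\<^sub>1, \<dots>, x\<^bsub>q-1\<^esub>\<close>, and \<open>xs ! i\<close> is the evaluation point
  of coordinate \<open>i\<close>.
\<close>

definition enum_units :: "'a::{field, finite} list \<Rightarrow> bool" where
  "enum_units xs \<longleftrightarrow> distinct xs \<and> set xs = UNIV - {0}"

definition words :: "nat \<Rightarrow> 'a list set" where
  "words n = {w. length w = n}"

definition eval_word :: "'a::comm_semiring_0 list \<Rightarrow> 'a poly \<Rightarrow> 'a list" where
  "eval_word xs f = map (poly f) xs"

text \<open>
  The zero polynomial (of degree \<open>-\<infinity>\<close> on paper, of degree \<open>0\<close> in the library) is listed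
  separately, so that \<open>degree g < k\<close> expresses the bound \<open>deg g \<le> k - 1\<close> without truncated
  subtraction.
\<close>

definition rs_code :: "'a::field list \<Rightarrow> nat \<Rightarrow> 'a list set" where
  "rs_code xs k = {eval_word xs g | g. g = 0 \<or> degree g < k}"

text \<open>Only meaningful for words of equal length.\<close>

definition hamming_dist :: "'a list \<Rightarrow> 'a list \<Rightarrow> nat" where
  "hamming_dist u v = card {i. i < length u \<and> u ! i \<noteq> v ! i}"

definition dist_to_code :: "'a list \<Rightarrow> 'a list set \<Rightarrow> nat" where
  "dist_to_code w C = Min (hamming_dist w ` C)"

text \<open>
  The minimum above and the maximum below are taken over finite nonempty sets when \<open>C\<close> is a nonempty
  subset of \<open>words n\<close> and the alphabet is finite.
\<close>

definition covering_radius :: "nat \<Rightarrow> 'a list set \<Rightarrow> nat" where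
  "covering_radius n C = Max ((\<lambda>y. dist_to_code y C) ` words n)"

definition deep_hole :: "nat \<Rightarrow> 'a list set \<Rightarrow> 'a list \<Rightarrow> bool" where
  "deep_hole n C w \<longleftrightarrow> w \<in> words n \<and> dist_to_code w C = covering_radius n C"

end

theory Submission
  imports Defs "HOL-Number_Theory.Cong"
begin

text \<open>
  The Artin--Schreier map \<open>\<phi>(x) = x\<^sup>p - x\<close> is additive on \<open>\<bbbF>\<^sub>q\<close> and vanishes on the prime field, so
  its nonempty fibres are the cosets of the prime field, with \<open>p\<close> elements each.  Write
  \<open>k + d = p m\<close>.  As \<open>p m < q\<close>, there are at least \<open>m + 1\<close> fibres, so one can choose a set \<open>A\<close> of
  \<open>m\<close> nonzero values of \<open>\<phi>\<close>.  The polynomial \<open>P = \<Prod>\<^bsub>a\<in>A\<^esub> (T\<^sup>p - T - a)\<close> vanishes at the \<open>k + d\<close> points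
  of the fibres over \<open>A\<close>, none of which is \<open>0\<close> because \<open>\<phi>(0) = 0\<close>.  The point of this choice is that
  \<open>P\<close> is sparse at the top: \<open>T\<^sup>p - T - a\<close> has a gap between the degrees \<open>p\<close> and \<open>1\<close>, and therefore
  \<open>T\<^sup>k\<^sup>+\<^sup>d - P\<close> has degree at most \<open>k + d - (p - 1)\<close>, which is less than \<open>k\<close> because \<open>p > d + 1\<close>.
  Hence \<open>T\<^sup>k\<^sup>+\<^sup>d - P\<close> generates a codeword that agrees with the given word in at least \<open>k + d\<close> places,
  so that the distance of this word to the code is at most \<open>q - 1 - (k + d)\<close>
  (\<open>ex_close_low_degree_poly\<close>).

  This is too close for a deep hole: the word of \<open>T\<^sup>k\<close> agrees with each codeword in at most \<open>k\<close>
  places, since \<open>T\<^sup>k - g\<close> is a nonzero polynomial of degree \<open>k\<close>.  So the covering radius is at least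
  \<open>q - 1 - k\<close> (\<open>covering_radius_rs_code_ge\<close>).
\<close>

section \<open>The Artin--Schreier map\<close>

definition artin_schreier :: "'a::comm_ring_1 \<Rightarrow> 'a" where
  "artin_schreier x = x ^ CHAR('a) - x"

lemma prime_CHAR_finite_field: "prime CHAR('a::{field, finite})"
  by (intro prime_CHAR_semidom finite_imp_CHAR_pos) auto

lemma of_nat_power_CHAR: "(of_nat i :: 'a::{field, finite}) ^ CHAR('a) = of_nat i"
proof (induction i)
  case 0
  then show ?case
    using prime_gt_0_nat[OF prime_CHAR_finite_field[where ?'a = 'a]] by simp
next
  case (Suc i)
  then show ?case
    using freshmans_dream[OF prime_CHAR_finite_field[where ?'a = 'a] refl, of 1 "of_nat i"]
    by simp
qed

lemma artin_schreier_add_of_nat: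
  "artin_schreier (x + of_nat i :: 'a::{field, finite}) = artin_schreier x"
  using freshmans_dream[OF prime_CHAR_finite_field[where ?'a = 'a] refl, of x "of_nat i"]
  by (simp add: artin_schreier_def of_nat_power_CHAR)

definition artin_schreier_poly :: "'a::comm_ring_1 \<Rightarrow> 'a poly" where
  "artin_schreier_poly a = monom 1 CHAR('a) - [:a, 1:]"

lemma poly_artin_schreier_poly: "poly (artin_schreier_poly a) x = artin_schreier x - a"
  by (simp add: artin_schreier_poly_def artin_schreier_def poly_monom)

lemma degree_artin_schreier_poly:
  "degree (artin_schreier_poly (a :: 'a::{field, finite})) = CHAR('a)"
proof -
  have "degree [:a, 1:] < degree (monom (1::'a) CHAR('a))"
    using prime_gt_1_nat[OF prime_CHAR_finite_field[where ?'a = 'a]] by (simp add: degree_monom_eq)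
  then show ?thesis
    unfolding artin_schreier_poly_def diff_conv_add_uminus
    by (subst degree_add_eq_left) (auto simp: degree_monom_eq)
qed

text \<open>
  A fibre contains the \<open>p\<close> translates of each of its points by the prime field, and it has no more
  points because \<open>T\<^sup>p - T - a\<close> has degree \<open>p\<close>.
\<close>

lemma card_artin_schreier_fibre:
  fixes a :: "'a::{field, finite}"
  assumes "a \<in> range artin_schreier"
  shows "card {x. artin_schreier x = a} = CHAR('a)"
proof (rule antisym)
  have "artin_schreier_poly a \<noteq> 0"
    using degree_artin_schreier_poly[of a]
      prime_gt_0_nat[OF prime_CHAR_finite_field[where ?'a = 'a]] by auto
  from card_poly_roots_bound[OF this] show "card {x. artin_schreier x = a} \<le> CHAR('a)"
    by (simp add: poly_artin_schreier_poly degree_artin_schreier_poly)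
next
  obtain b where b: "artin_schreier b = a"
    using assms by auto
  have "inj_on (\<lambda>i. b + of_nat i) {..<CHAR('a)}"
    by (auto simp: inj_on_def of_nat_eq_iff_cong_CHAR cong_def)
  then have "CHAR('a) = card ((\<lambda>i. b + of_nat i) ` {..<CHAR('a)})"
    by (simp add: card_image)
  also have "\<dots> \<le> card {x. artin_schreier x = a}"
    by (intro card_mono) (auto simp: artin_schreier_add_of_nat b)
  finally show "CHAR('a) \<le> card {x. artin_schreier x = a}" .
qed

lemma card_artin_schreier_vimage:
  fixes A :: "'a::{field, finite} set"
  assumes "A \<subseteq> range artin_schreier"
  shows "card (artin_schreier -` A) = CHAR('a) * card A"
proof -
  have "artin_schreier -` A = (\<Union>a\<in>A. {x. artin_schreier x = a})"
    by auto
  then have "card (artin_schreier -` A) = (\<Sum>a\<in>A. card {x. artin_schreier x = a})"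
    by (simp only:) (rule card_UN_disjoint, auto)
  also have "\<dots> = (\<Sum>a\<in>A. CHAR('a))"
    using assms by (intro sum.cong refl card_artin_schreier_fibre) auto
  finally show ?thesis
    by simp
qed

section \<open>A polynomial of low degree close to a monomial\<close>

text \<open>
  Passing from \<open>P\<close> to \<open>(T\<^sup>p - T - a) P\<close> shifts the lower part of \<open>P\<close> by \<open>p\<close> and adds the terms of
  \<open>-(T + a) P\<close>, whose degree is \<open>p - 1\<close> below that of the new leading term; so the gap of length
  \<open>p - 1\<close> below the leading term persists.
\<close>

lemma degree_prod_artin_schreier_poly_gap:
  fixes A :: "'a::{field, finite} set"
  assumes "A \<noteq> {}"
  defines "p \<equiv> CHAR('a)"
  shows "degree ((\<Prod>a\<in>A. artin_schreier_poly a) - monom 1 (p * card A)) + (p - 1) \<le> p * card A"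
proof -
  have "finite A"
    by simp
  then show ?thesis
    using assms(1)
  proof (induction A rule: finite_ne_induct)
    case (singleton a)
    have "1 \<le> p"
      using prime_gt_0_nat[OF prime_CHAR_finite_field[where ?'a = 'a]] by (simp add: p_def)
    then show ?case
      by (simp add: artin_schreier_poly_def p_def)
  next
    case (insert a A)
    define P where "P = (\<Prod>a\<in>A. artin_schreier_poly a)"
    define N where "N = p * card A"
    have P: "degree P \<le> N"
      unfolding P_def N_def using degree_prod_sum_le[of A artin_schreier_poly]
      by (simp add: degree_artin_schreier_poly p_def mult.commute)
    have IH: "degree (P - monom 1 N) + (p - 1) \<le> N"
      using insert.IH by (simp add: P_def N_def)
    have p: "1 \<le> p"
      using prime_gt_0_nat[OF prime_CHAR_finite_field[where ?'a = 'a]] by (simp add: p_def)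
    have "(\<Prod>a\<in>insert a A. artin_schreier_poly a) - monom 1 (p * card (insert a A))
        = monom 1 p * (P - monom 1 N) - [:a, 1:] * P"
      using insert.hyps by (simp add: P_def N_def artin_schreier_poly_def p_def
          algebra_simps mult_monom)
    moreover have "degree (monom 1 p * (P - monom 1 N)) \<le> N + 1"
      using degree_mult_le[of "monom 1 p" "P - monom 1 N"] IH p
      by (simp add: degree_monom_eq)
    moreover have "degree ([:a, 1:] * P) \<le> N + 1"
      using degree_mult_le[of "[:a, 1:]" P] P by simp
    ultimately have "degree ((\<Prod>a\<in>insert a A. artin_schreier_poly a)
        - monom 1 (p * card (insert a A))) \<le> N + 1"
      by (simp add: degree_diff_le)
    then show ?case
      using insert.hyps p by (simp add: N_def)
  qed
qed

text \<open>
  The fibres used must avoid the point \<open>0\<close>, that is, the fibre over \<open>0\<close>; this is where the strict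
  inequality \<open>n < q\<close> is needed.
\<close>

lemma ex_close_low_degree_poly:
  fixes n :: nat
  assumes "CHAR('a::{field, finite}) dvd n" and "0 < n" and "n < CARD('a::{field, finite})"
  obtains g :: "'a::{field, finite} poly" and S
  where "degree g + (CHAR('a::{field, finite}) - 1) \<le> n" and "card S = n" and "0 \<notin> S"
    and "\<And>x. x \<in> S \<Longrightarrow> poly g x = poly (monom 1 n) x"
proof -
  let ?p = "CHAR('a)"
  let ?\<phi> = "artin_schreier :: 'a \<Rightarrow> 'a"
  obtain m where m: "n = ?p * m"
    using assms(1) by (auto elim: dvdE)
  have \<phi>0: "?\<phi> 0 = 0"
    using artin_schreier_add_of_nat[of 0 0] prime_gt_0_nat[OF prime_CHAR_finite_field[where ?'a = 'a]]
    by (simp add: artin_schreier_def)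
  then have "0 \<in> range ?\<phi>"
    by (metis rangeI)
  have "CARD('a) = ?p * card (range ?\<phi>)"
    using card_artin_schreier_vimage[of "range ?\<phi>"] by (simp add: vimage_def)
  then have "m < card (range ?\<phi>)"
    using assms(3) m by simp
  then have "m \<le> card (range ?\<phi> - {0})"
    using \<open>0 \<in> range ?\<phi>\<close> by simp
  then obtain A where A: "A \<subseteq> range ?\<phi> - {0}" "card A = m"
    by (rule obtain_subset_with_card_n)
  define P where "P = (\<Prod>a\<in>A. artin_schreier_poly a)"
  show thesis
  proof
    have "A \<noteq> {}"
      using A m assms(2) by auto
    from degree_prod_artin_schreier_poly_gap[OF this]
    show "degree (monom 1 n - P) + (?p - 1) \<le> n"
      using degree_minus[of "P - monom 1 n"] by (simp add: P_def A m)
    show "card (?\<phi> -` A) = n"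
      using A m by (subst card_artin_schreier_vimage) auto
    show "0 \<notin> ?\<phi> -` A"
      using A \<phi>0 by auto
    show "poly (monom 1 n - P) x = poly (monom 1 n) x" if "x \<in> ?\<phi> -` A" for x
      using that by (auto simp: P_def poly_prod poly_artin_schreier_poly)
  qed
qed

section \<open>Distances to the code\<close>

lemma hamming_dist_eval_word:
  assumes "distinct xs"
  shows "hamming_dist (eval_word xs f) (eval_word xs g) = card {x \<in> set xs. poly f x \<noteq> poly g x}"
proof -
  have "{x \<in> set xs. poly f x \<noteq> poly g x}
      = (!) xs ` {i. i < length xs \<and> poly f (xs ! i) \<noteq> poly g (xs ! i)}"
    by (auto simp: in_set_conv_nth)
  moreover have "inj_on ((!) xs) {i. i < length xs \<and> poly f (xs ! i) \<noteq> poly g (xs ! i)}"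
    using assms by (auto simp: inj_on_def nth_eq_iff_index_eq)
  moreover have "{i. i < length (eval_word xs f) \<and> eval_word xs f ! i \<noteq> eval_word xs g ! i}
      = {i. i < length xs \<and> poly f (xs ! i) \<noteq> poly g (xs ! i)}"
    by (auto simp: eval_word_def)
  ultimately show ?thesis
    by (simp add: hamming_dist_def card_image)
qed

lemma finite_words: "finite (words n :: 'a::finite list set)"
  using finite_lists_length_eq[of "UNIV :: 'a set" n] by (simp add: words_def)

lemma eval_word_in_words: "eval_word xs f \<in> words (length xs)"
  by (simp add: eval_word_def words_def)

lemma finite_rs_code: "finite (rs_code (xs :: 'a::{field, finite} list) k)"
  by (rule finite_subset[OF _ finite_words[of "length xs"]])
    (auto simp: rs_code_def eval_word_in_words)

lemma dist_to_rs_code_le: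
  fixes xs :: "'a::{field, finite} list"
  assumes "distinct xs" and "degree g < k"
  shows "dist_to_code (eval_word xs f) (rs_code xs k) \<le> card {x \<in> set xs. poly f x \<noteq> poly g x}"
  unfolding dist_to_code_def hamming_dist_eval_word[OF assms(1), symmetric]
  using assms(2) by (intro Min_le finite_imageI finite_rs_code) (auto simp: rs_code_def)

text \<open>The word of \<open>T\<^sup>k\<close> is at least this far from the code: a codeword agreeing with it in more than
  \<open>k\<close> places would give a monic polynomial of degree \<open>k\<close> with more than \<open>k\<close> roots.\<close>

lemma covering_radius_rs_code_ge:
  fixes xs :: "'a::{field, finite} list"
  assumes "distinct xs" and "k > 0"
  shows "length xs - k \<le> covering_radius (length xs) (rs_code xs k)"
proof -
  let ?w = "eval_word xs (monom 1 k)"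
  have "length xs - k \<le> hamming_dist ?w c" if c_code: "c \<in> rs_code xs k" for c
  proof -
    obtain g where c: "c = eval_word xs g" and "g = 0 \<or> degree g < k"
      using c_code by (auto simp: rs_code_def)
    then have g: "degree g < k"
      using assms(2) by auto
    let ?h = "monom 1 k - g"
    have "coeff ?h k = 1"
      using g by (simp add: coeff_eq_0)
    then have "?h \<noteq> 0"
      by auto
    have "degree ?h \<le> k"
      using g by (intro degree_diff_le) (auto simp: degree_monom_le)
    have "length xs = card (set xs)"
      using assms(1) by (simp add: distinct_card)
    also have "set xs = {x \<in> set xs. poly (monom 1 k) x \<noteq> poly g x} \<union> {x \<in> set xs. poly ?h x = 0}"
      by auto
    also have "card \<dots> \<le> hamming_dist ?w c + card {x \<in> set xs. poly ?h x = 0}"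
      unfolding c hamming_dist_eval_word[OF assms(1)] by (rule card_Un_le)
    also have "card {x \<in> set xs. poly ?h x = 0} \<le> card {x. poly ?h x = 0}"
      by (intro card_mono) auto
    also have "\<dots> \<le> k"
      using card_poly_roots_bound[OF \<open>?h \<noteq> 0\<close>] \<open>degree ?h \<le> k\<close> by linarith
    finally show ?thesis
      by simp
  qed
  moreover have "rs_code xs k \<noteq> {}"
    by (auto simp: rs_code_def)
  ultimately have "length xs - k \<le> dist_to_code ?w (rs_code xs k)"
    unfolding dist_to_code_def by (subst Min_ge_iff) (auto simp: finite_rs_code)
  also have "\<dots> \<le> covering_radius (length xs) (rs_code xs k)"
    unfolding covering_radius_def
    by (intro Max_ge finite_imageI finite_words imageI eval_word_in_words)
  finally show ?thesis .
qed

theorem proposition4p5: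
  fixes xs :: "'a::{field, finite} list"
    and p q k d :: nat
  assumes "CARD('a) = q" and "CHAR('a) = p"
    and "enum_units xs"
    and "k > 0" and "d > 0"
    and "k > d" and "p > d + 1" and "q > k + d"
    and "p dvd (k + d)"
  shows "\<not> deep_hole (q - 1) (rs_code xs k) (eval_word xs (monom 1 (k + d)))"
proof -
  have xs: "distinct xs" "set xs = UNIV - {0}"
    using assms(3) by (auto simp: enum_units_def)
  have len: "length xs = q - 1"
    using xs assms(1) by (simp flip: distinct_card)
  obtain g :: "'a poly" and S where g: "degree g + (p - 1) \<le> k + d"
    and S: "card S = k + d" "0 \<notin> S" "\<And>x. x \<in> S \<Longrightarrow> poly g x = poly (monom 1 (k + d)) x"
    using ex_close_low_degree_poly[where ?'a = 'a, of "k + d"] assms by auto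
  have "degree g < k"
    using g assms(7) by linarith
  then have "dist_to_code (eval_word xs (monom 1 (k + d))) (rs_code xs k)
      \<le> card {x \<in> set xs. poly (monom 1 (k + d)) x \<noteq> poly g x}"
    by (rule dist_to_rs_code_le[OF xs(1)])
  also have "\<dots> \<le> card (set xs - S)"
    using S(3) by (intro card_mono) auto
  also have "\<dots> = q - 1 - (k + d)"
    using S xs len assms(1) by (subst card_Diff_subset) auto
  also have "\<dots> < q - 1 - k"
    using assms(5,8) by linarith
  also have "\<dots> \<le> covering_radius (q - 1) (rs_code xs k)"
    using covering_radius_rs_code_ge[OF xs(1) assms(4)] by (simp add: len)
  finally show ?thesis
    by (simp add: deep_hole_def)
qed

end
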